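(* Let 2 players $A,B$ divide 3 cakes, each cut into $k\ge 4$ pieces, and let the players have preferences $\mathrm{Pref}_A,\mathrm{Pref}_B$ satisfying the assumptions described in the context. Then there exist a division $x$ and disjoint piece selections $s_A\in\mathrm{Pref}_A(x)$, $s_B\in\mathrm{Pref}_B(x)$ (disjoint envy-free piece selections).
   Context: Model of multi-cake division. There are $m$ cakes (here $m=3$), each of length $1$, and each cake is cut into $k$ pieces. A division is an $m\times k$ matrix $x=(x_{ij})$ with $x_{ij}\ge 0$ and $\sum_{j} x_{ij}=1$ for every $i$; $x_{ij}$ is the length of the $j$-th piece of cake $i$. A piece selection is a map $s:\{1,\dots,m\}\to\{1,\dots,k\}$ choosing one piece from each cake. Two piece selections $s,s'$ are disjoint if $s(i)\ne s'(i)$ for every cake $i$. Each player has preferences given by assigning to every division $x$ a nonempty set $\mathrm{Pref}(x)$ of preferred piece selections (those not worse than any other at $x$ for that player); each player's preferences depend only on that player. Assumptions: (hungry) no $s\in\mathrm{Pref}(x)$ contains an empty piece, i.e. $x_{i,s(i)}>0$ for all $i$ (a player prefers a nonempty piece in a cake to an empty piece in that cake, other cakes fixed); (closed) for each piece selection $s$ the set of divisions $x$ with $s\in\mathrm{Pref}(x)$ is closed. *)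

theory Defs
  imports "HOL-Analysis.Analysis"
begin

text \<open>
  Cakes are indexed by the finite type \<open>'m\<close>, the pieces of each cake by the finite type \<open>'k\<close>;
  \<open>x $ i $ j\<close> is the length of the \<open>j\<close>-th piece of cake \<open>i\<close>.
\<close>

definition divisions :: "(real ^ 'k::finite ^ 'm::finite) set" where
  "divisions = {x. (\<forall>i j. 0 \<le> x $ i $ j) \<and> (\<forall>i. (\<Sum>j\<in>UNIV. x $ i $ j) = 1)}"

type_synonym ('m, 'k) selection = "'m \<Rightarrow> 'k"

definition disjoint_selections :: "('m, 'k) selection \<Rightarrow> ('m, 'k) selection \<Rightarrow> bool" where
  "disjoint_selections s s' \<longleftrightarrow> (\<forall>i. s i \<noteq> s' i)"

text \<open>
  A player's preferences assign to every division the set of preferred piece selections.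
  Values outside \<^const>\<open>divisions\<close> are irrelevant and left unconstrained.
\<close>

type_synonym ('m, 'k) preferences = "real ^ 'k ^ 'm \<Rightarrow> ('m, 'k) selection set"

definition nonempty_preferences :: "('m::finite, 'k::finite) preferences \<Rightarrow> bool" where
  "nonempty_preferences Pref \<longleftrightarrow> (\<forall>x\<in>divisions. Pref x \<noteq> {})"

definition hungry :: "('m::finite, 'k::finite) preferences \<Rightarrow> bool" where
  "hungry Pref \<longleftrightarrow> (\<forall>x\<in>divisions. \<forall>s\<in>Pref x. \<forall>i. x $ i $ s i > 0)"

text \<open>
  Closedness in the ambient space is the same as closedness relative to \<^const>\<open>divisions\<close>, since
  that set is itself closed.
\<close>

definition closed_preferences :: "('m::finite, 'k::finite) preferences \<Rightarrow> bool" where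
  "closed_preferences Pref \<longleftrightarrow> (\<forall>s. closed {x \<in> divisions. s \<in> Pref x})"

definition admissible_preferences :: "('m::finite, 'k::finite) preferences \<Rightarrow> bool" where
  "admissible_preferences Pref \<longleftrightarrow>
     nonempty_preferences Pref \<and> hungry Pref \<and> closed_preferences Pref"

end

theory Submission
  imports Defs
begin

text \<open>
  Smear each player's preferred set into a probability distribution on piece selections that varies
  continuously with the division and, by hungriness, never charges an empty piece. The average of
  the two players' marginals is then a face-preserving self-map of the product of simplices, so by
  Brouwer it attains the barycentre. There the marginals \<open>a\<close>, \<open>b\<close> of the players satisfy
  \<open>a\<^sub>i\<^sub>j + b\<^sub>i\<^sub>j = 2/k\<close>, hence \<open>a\<^sub>i\<^sub>j b\<^sub>i\<^sub>j \<le> 1/k\<^sup>2\<close>: two independently drawn selections agree on at most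
  \<open>m/k < 1\<close> cakes on average, so some pair of selections of positive probability is disjoint.
  Compactness removes the smearing.
\<close>

section \<open>The product of simplices as a compact convex set\<close>

lemma divisionsD:
  assumes "x \<in> divisions"
  shows "0 \<le> x $ i $ j" "(\<Sum>j\<in>UNIV. x $ i $ j) = 1"
  using assms by (auto simp: divisions_def)

lemma divisions_le_one: "x \<in> divisions \<Longrightarrow> x $ i $ j \<le> 1"
  using member_le_sum[of j UNIV "\<lambda>j. x $ i $ j"] by (simp add: divisionsD)

lemma closed_divisions: "closed (divisions :: (real ^ 'k::finite ^ 'm::finite) set)"
  unfolding divisions_def
  by (intro closed_Collect_conj closed_Collect_all closed_Collect_le closed_Collect_eq
        continuous_intros)

lemma bounded_divisions: "bounded (divisions :: (real ^ 'k::finite ^ 'm::finite) set)"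
proof (rule boundedI)
  fix x :: "real ^ 'k ^ 'm" assume x: "x \<in> divisions"
  have row: "norm (x $ i) \<le> 1" for i
    using norm_le_l1_cart[of "x $ i"] divisionsD[OF x] by simp
  have "norm x \<le> (\<Sum>i\<in>UNIV. norm (x $ i))"
    by (simp add: norm_vec_def L2_set_le_sum)
  also have "\<dots> \<le> (\<Sum>i\<in>(UNIV::'m set). 1)"
    by (intro sum_mono row)
  finally show "norm x \<le> real CARD('m)" by simp
qed

lemma compact_divisions: "compact (divisions :: (real ^ 'k::finite ^ 'm::finite) set)"
  using closed_divisions bounded_divisions by (simp add: compact_eq_bounded_closed)

lemma convex_divisions: "convex (divisions :: (real ^ 'k::finite ^ 'm::finite) set)"
  by (auto simp: convex_def divisions_def sum.distrib simp flip: sum_distrib_left)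

lemma divisions_nonempty: "(divisions :: (real ^ 'k::finite ^ 'm::finite) set) \<noteq> {}"
proof -
  have "(\<chi> i j. 1 / real CARD('k)) \<in> (divisions :: (real ^ 'k ^ 'm) set)"
    by (simp add: divisions_def)
  then show ?thesis by blast
qed

section \<open>Brouwer for face-preserving maps\<close>

text \<open>Brouwer is applied not to \<open>g\<close> but to an auxiliary map \<open>h\<close>
  whose fixed points are forced to be preimages of the barycentre; the face condition excludes fixed
  points of \<open>h\<close> on the boundary.\<close>

lemma face_preserving_attains_barycentre:
  fixes g :: "real ^ 'k::finite ^ 'm::finite \<Rightarrow> real ^ 'k ^ 'm"
  assumes cont: "continuous_on divisions g"
    and maps: "\<And>x. x \<in> divisions \<Longrightarrow> g x \<in> divisions"
    and face: "\<And>x i j. x \<in> divisions \<Longrightarrow> x $ i $ j = 0 \<Longrightarrow> g x $ i $ j = 0"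
  shows "\<exists>x\<in>divisions. \<forall>i j. g x $ i $ j = 1 / real CARD('k)"
proof -
  define c where "c = 1 / real CARD('k)"
  have c: "c > 0" "(\<Sum>j\<in>(UNIV::'k set). c) = 1" by (simp_all add: c_def)
  define d where "d x i j = max 0 (c - g x $ i $ j)" for x i j
  define S where "S x i = (\<Sum>j\<in>UNIV. d x i j)" for x i
  have d0: "d x i j \<ge> 0" for x i j by (simp add: d_def)
  have S0: "S x i \<ge> 0" for x i by (simp add: S_def sum_nonneg d0)
  have S1: "1 + S x i \<noteq> 0" for x i using S0[of x i] by linarith
  \<comment> \<open>\<open>h\<close> moves mass towards the pieces on which \<open>g\<close> falls short of the target \<open>c\<close>.\<close>
  define h where "h x = (\<chi> i j. (x $ i $ j + d x i j) / (1 + S x i))" for x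
  have "continuous_on divisions h"
    unfolding h_def S_def d_def
    by (intro continuous_intros cont) (use S1 in \<open>simp add: S_def d_def\<close>)
  moreover have "h \<in> divisions \<rightarrow> divisions"
  proof (rule funcsetI)
    fix x :: "real ^ 'k ^ 'm" assume x: "x \<in> divisions"
    have "(\<Sum>j\<in>UNIV. h x $ i $ j) = 1" for i
      using S1[of x i] divisionsD(2)[OF x, of i]
      by (simp add: h_def sum.distrib flip: sum_divide_distrib S_def)
    then show "h x \<in> divisions"
      using divisionsD(1)[OF x] d0 S0 by (simp add: divisions_def h_def)
  qed
  ultimately obtain x where x: "x \<in> divisions" and fix_x: "h x = x"
    using brouwer[OF compact_divisions convex_divisions divisions_nonempty] by blast
  have eq: "x $ i $ j * S x i = d x i j" for i j
  proof -
    have "h x $ i $ j = x $ i $ j" by (simp add: fix_x)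
    then show ?thesis using S1[of x i] by (simp add: h_def field_simps)
  qed
  have sum_g: "(\<Sum>j\<in>UNIV. g x $ i $ j) = 1" for i
    using maps[OF x] divisionsD(2) by blast
  \<comment> \<open>If \<open>S x i > 0\<close>, every entry of row \<open>i\<close> of
    \<open>g x\<close> lies below \<open>c\<close>: on empty pieces by \<open>face\<close>, on the
    others because \<open>eq\<close> makes \<open>d x i j\<close> positive. Such a row cannot sum to
    1.\<close>
  have "S x i = 0" for i
  proof (rule ccontr)
    assume "S x i \<noteq> 0"
    then have Spos: "S x i > 0" using S0[of x i] by linarith
    have "g x $ i $ j < c" for j
    proof (cases "x $ i $ j = 0")
      case True
      then show ?thesis using face[OF x] c by simp
    next
      case False
      then have "d x i j > 0"
        using Spos divisionsD(1)[OF x, of i j] eq[of i j] by (metis less_eq_real_def mult_pos_pos)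
      then show ?thesis by (simp add: d_def split: if_splits)
    qed
    then have "(\<Sum>j\<in>UNIV. g x $ i $ j) < (\<Sum>j\<in>(UNIV::'k set). c)"
      by (intro sum_strict_mono) auto
    then show False using sum_g c by simp
  qed
  then have ge: "g x $ i $ j \<ge> c" for i j
    using eq[of i j] by (simp add: d_def)
  \<comment> \<open>No entry lies below \<open>c\<close>, which is the mean of the row, so all
    entries equal it.\<close>
  have "g x $ i $ j = c" for i j
  proof -
    have "(\<Sum>j\<in>UNIV. g x $ i $ j - c) = 0"
      using sum_g[of i] c by (simp add: sum_subtractf)
    then show ?thesis
      using ge by (subst (asm) sum_nonneg_eq_0_iff) auto
  qed
  then show ?thesis using x by (auto simp: c_def)
qed

section \<open>Continuous randomisation of preferences\<close>

text \<open>Continuity in \<open>x\<close> has a price: a selection charged at \<open>x\<close> is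
  only known to be preferred at some division within \<open>e\<close>. Vanishing on empty pieces is
  demanded exactly, since face preservation of the marginals rests on it.\<close>

definition smearing ::
    "('m::finite, 'k::finite) preferences \<Rightarrow> real \<Rightarrow> (real ^ 'k ^ 'm \<Rightarrow> ('m \<Rightarrow> 'k) \<Rightarrow> real) \<Rightarrow> bool" where
  "smearing Pref e p \<longleftrightarrow>
     (\<forall>s. continuous_on divisions (\<lambda>x. p x s)) \<and>
     (\<forall>x\<in>divisions. (\<forall>s. 0 \<le> p x s) \<and> (\<Sum>s\<in>UNIV. p x s) = 1 \<and>
        (\<forall>s i. x $ i $ s i = 0 \<longrightarrow> p x s = 0) \<and>
        (\<forall>s. 0 < p x s \<longrightarrow> (\<exists>y\<in>divisions. s \<in> Pref y \<and> dist x y < e)))"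

lemma smearingD:
  assumes "smearing Pref e p"
  shows "continuous_on divisions (\<lambda>x. p x s)"
    and "x \<in> divisions \<Longrightarrow> 0 \<le> p x s"
    and "x \<in> divisions \<Longrightarrow> (\<Sum>s\<in>UNIV. p x s) = 1"
    and "x \<in> divisions \<Longrightarrow> x $ i $ s i = 0 \<Longrightarrow> p x s = 0"
    and "x \<in> divisions \<Longrightarrow> 0 < p x s \<Longrightarrow> \<exists>y\<in>divisions. s \<in> Pref y \<and> dist x y < e"
  using assms unfolding smearing_def by blast+

text \<open>Bump functions around the closed sets \<open>C s\<close>, damped by the piece lengths,
  are normalised to total 1. The normaliser is positive because a selection preferred at
  \<open>x\<close> has bump value \<open>e\<close> there and, by hungriness, only nonempty
  pieces.\<close>

lemma smearing_exists:
  fixes Pref :: "('m::finite, 'k::finite) preferences"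
  assumes adm: "admissible_preferences Pref" and e: "e > 0"
  shows "\<exists>p. smearing Pref e p"
proof -
  define C where "C s = {x \<in> divisions. s \<in> Pref x}" for s
  have clC: "closed (C s)" for s
    using adm by (simp add: C_def admissible_preferences_def closed_preferences_def)
  \<comment> \<open>The case distinction is needed since the distance to the empty set is \<open>0\<close>.\<close>
  define v where "v x s = (if C s = {} then 0 else max 0 (e - infdist x (C s)))" for x s
  \<comment> \<open>The product makes the weight vanish on every face where the selection has an empty piece.\<close>
  define w where "w x s = v x s * (\<Prod>i\<in>UNIV. x $ i $ s i)" for x s
  define W where "W x = (\<Sum>s\<in>UNIV. w x s)" for x
  have v0: "v x s \<ge> 0" for x s by (simp add: v_def)
  have w0: "w x s \<ge> 0" if "x \<in> divisions" for x s
    using that by (simp add: w_def v0 prod_nonneg divisionsD)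
  have Wpos: "W x > 0" if x: "x \<in> divisions" for x
  proof -
    obtain s where s: "s \<in> Pref x"
      using adm x by (auto simp: admissible_preferences_def nonempty_preferences_def)
    then have "\<And>i. x $ i $ s i > 0"
      using adm x by (auto simp: admissible_preferences_def hungry_def)
    then have "(\<Prod>i\<in>UNIV. x $ i $ s i) > 0" by (simp add: prod_pos)
    moreover have "x \<in> C s" using s x by (simp add: C_def)
    then have "v x s > 0" using e by (auto simp: v_def)
    ultimately have "w x s > 0" by (simp add: w_def)
    then show ?thesis
      unfolding W_def using w0[OF x] by (intro sum_pos2[of _ s]) auto
  qed
  have contv: "continuous_on divisions (\<lambda>x. v x s)" for s
    by (cases "C s = {}") (auto simp: v_def intro!: continuous_intros)
  have contw: "continuous_on divisions (\<lambda>x. w x s)" for s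
    unfolding w_def by (intro continuous_intros contv)
  have contW: "continuous_on divisions W"
    unfolding W_def by (intro continuous_intros contw)
  define p where "p x s = w x s / W x" for x s
  have "smearing Pref e p"
    unfolding smearing_def
  proof (intro conjI allI ballI impI)
    show "continuous_on divisions (\<lambda>x. p x s)" for s
      unfolding p_def using Wpos by (intro continuous_on_divide contw contW) force
    show "0 \<le> p x s" if "x \<in> divisions" for x s
      using w0[OF that] Wpos[OF that] by (simp add: p_def)
    show "(\<Sum>s\<in>UNIV. p x s) = 1" if "x \<in> divisions" for x
      using Wpos[OF that] by (simp add: p_def flip: sum_divide_distrib W_def)
    show "p x s = 0" if "x \<in> divisions" "x $ i $ s i = 0" for x s i
      using that by (auto simp: p_def w_def intro: prod_zero)
    show "\<exists>y\<in>divisions. s \<in> Pref y \<and> dist x y < e" if "x \<in> divisions" "p x s > 0" for x s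
    proof -
      have "v x s > 0"
        using that v0[of x s] by (auto simp: p_def w_def less_le)
      then have ne: "C s \<noteq> {}" and lt: "infdist x (C s) < e"
        by (auto simp: v_def split: if_splits)
      obtain y where "y \<in> C s" "infdist x (C s) = dist x y"
        using infdist_attains_inf[OF clC ne] by blast
      then show ?thesis using lt by (auto simp: C_def)
    qed
  qed
  then show ?thesis by blast
qed

section \<open>Marginals and the first-moment bound\<close>

definition marginals :: "(('m::finite \<Rightarrow> 'k::finite) \<Rightarrow> real) \<Rightarrow> real ^ 'k ^ 'm" where
  "marginals p = (\<chi> i j. \<Sum>s\<in>UNIV. if s i = j then p s else 0)"

text \<open>Both sides are the expectation of \<open>f (s i)\<close> for \<open>s\<close> drawn from
  \<open>p\<close>. Constant \<open>f\<close> gives the row sums; a marginal of a second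
  distribution gives the probability of agreement on cake \<open>i\<close>.\<close>

lemma sum_marginals:
  "(\<Sum>j\<in>UNIV. marginals p $ i $ j * f j) = (\<Sum>s\<in>UNIV. p s * f (s i))"
proof -
  have "(\<Sum>j\<in>UNIV. marginals p $ i $ j * f j)
      = (\<Sum>j\<in>UNIV. \<Sum>s\<in>UNIV. if s i = j then p s * f j else 0)"
    unfolding marginals_def by (auto simp: sum_distrib_right intro!: sum.cong)
  also have "\<dots> = (\<Sum>s\<in>UNIV. \<Sum>j\<in>UNIV. if s i = j then p s * f j else 0)"
    by (rule sum.swap)
  finally show ?thesis by simp
qed

lemma marginals_in_divisions:
  assumes "\<And>s. 0 \<le> p s" "(\<Sum>s\<in>UNIV. p s) = 1"
  shows "marginals p \<in> divisions"
  using sum_marginals[of p _ "\<lambda>_. 1"] assms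
  by (auto simp: divisions_def marginals_def intro!: sum_nonneg)

text \<open>First-moment method: \<open>N s t\<close> counts the cakes on which \<open>s\<close> and
  \<open>t\<close> agree. Without a disjoint pair in the support its mean under independent draws is
  at least 1, yet it is at most m/k.\<close>

lemma disjoint_pair_in_support:
  fixes p q :: "('m::finite \<Rightarrow> 'k::finite) \<Rightarrow> real"
  assumes p: "\<And>s. 0 \<le> p s" "(\<Sum>s\<in>UNIV. p s) = 1"
    and q: "\<And>s. 0 \<le> q s" "(\<Sum>s\<in>UNIV. q s) = 1"
    and avg: "\<And>i j. marginals p $ i $ j + marginals q $ i $ j = 2 / real CARD('k)"
    and card: "CARD('m) < CARD('k)"
  shows "\<exists>s t. p s > 0 \<and> q t > 0 \<and> disjoint_selections s t"
proof (rule ccontr)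
  assume none: "\<not> ?thesis"
  define N where "N s t = (\<Sum>i\<in>UNIV. if s i = t i then 1 else 0 :: real)" for s t :: "'m \<Rightarrow> 'k"
  have N: "p s * q t \<le> p s * (q t * N s t)" for s t
  proof (cases "p s > 0 \<and> q t > 0")
    case True
    with none obtain i where "s i = t i" by (auto simp: disjoint_selections_def)
    then have "1 \<le> N s t"
      unfolding N_def
      using member_le_sum[of i UNIV "\<lambda>i. if s i = t i then 1 else 0 :: real"] by simp
    with True show ?thesis by simp
  next
    case False
    then have "p s = 0 \<or> q t = 0" using p(1)[of s] q(1)[of t] by linarith
    then show ?thesis by auto
  qed
  have "1 = (\<Sum>s\<in>UNIV. \<Sum>t\<in>UNIV. p s * q t)"
    using p(2) q(2) by (simp flip: sum_distrib_left sum_distrib_right)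
  also have "\<dots> \<le> (\<Sum>s\<in>UNIV. \<Sum>t\<in>UNIV. p s * (q t * N s t))"
    by (intro sum_mono N)
  also have "\<dots> = (\<Sum>s\<in>UNIV. \<Sum>t\<in>UNIV. \<Sum>i\<in>UNIV. p s * (if t i = s i then q t else 0))"
    unfolding N_def sum_distrib_left by (intro sum.cong) auto
  also have "\<dots> = (\<Sum>s\<in>UNIV. \<Sum>i\<in>UNIV. p s * marginals q $ i $ s i)"
    by (subst sum.swap) (simp add: marginals_def sum_distrib_left)
  also have "\<dots> = (\<Sum>i\<in>UNIV. \<Sum>s\<in>UNIV. p s * marginals q $ i $ s i)"
    by (rule sum.swap)
  also have "\<dots> = (\<Sum>i\<in>UNIV. \<Sum>j\<in>UNIV. marginals p $ i $ j * marginals q $ i $ j)"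
    by (simp add: sum_marginals)
  \<comment> \<open>By AM-GM, two numbers with sum 2/k have product at most (1/k)^2.\<close>
  also have "\<dots> \<le> (\<Sum>i\<in>(UNIV::'m set). \<Sum>j\<in>(UNIV::'k set). (1 / real CARD('k))\<^sup>2)"
  proof (intro sum_mono)
    fix i :: 'm and j :: 'k
    let ?a = "marginals p $ i $ j" and ?b = "marginals q $ i $ j"
    have "0 \<le> (?a - ?b)\<^sup>2" by simp
    then have "4 * (?a * ?b) \<le> (?a + ?b)\<^sup>2" by (simp add: power2_eq_square algebra_simps)
    then show "?a * ?b \<le> (1 / real CARD('k))\<^sup>2" by (simp add: avg power_divide)
  qed
  also have "\<dots> = real CARD('m) / real CARD('k)"
    by (simp add: power2_eq_square)
  also have "\<dots> < 1" using card by simp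
  finally show False by simp
qed

section \<open>From approximate to exact solutions\<close>

lemma approximate_disjoint_selections:
  fixes PrefA PrefB :: "('m::finite, 'k::finite) preferences"
  assumes card: "CARD('m) < CARD('k)"
    and A: "admissible_preferences PrefA" and B: "admissible_preferences PrefB"
    and e: "e > 0"
  obtains y z s t where "y \<in> divisions" "s \<in> PrefA y" "z \<in> divisions" "t \<in> PrefB z"
    "disjoint_selections s t" "dist y z < e"
proof -
  from e have e2: "e / 2 > 0" by simp
  obtain p where "smearing PrefA (e / 2) p" using smearing_exists[OF A e2] ..
  note p = smearingD[OF this]
  obtain q where "smearing PrefB (e / 2) q" using smearing_exists[OF B e2] ..
  note q = smearingD[OF this]
  define g where "g x = (1/2) *\<^sub>R marginals (p x) + (1/2) *\<^sub>R marginals (q x)" for x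
  have cont_marg: "continuous_on divisions (\<lambda>x. marginals (r x))"
    if "\<And>s. continuous_on divisions (\<lambda>x. r x s)" for r :: "real ^ 'k ^ 'm \<Rightarrow> ('m \<Rightarrow> 'k) \<Rightarrow> real"
    unfolding marginals_def
  proof (intro continuous_intros)
    show "continuous_on divisions (\<lambda>x. if s i = j then r x s else 0)" for s i j
      by (cases "s i = j") (auto simp: that)
  qed
  have "\<exists>x\<in>divisions. \<forall>i j. g x $ i $ j = 1 / real CARD('k)"
  proof (rule face_preserving_attains_barycentre)
    show "continuous_on divisions g"
      unfolding g_def by (intro continuous_intros cont_marg p(1) q(1))
    show "g x \<in> divisions" if "x \<in> divisions" for x
      unfolding g_def using that p q
      by (intro convexD[OF convex_divisions] marginals_in_divisions) auto
    \<comment> \<open>Every selection that picks the empty piece \<open>j\<close> of cake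
      \<open>i\<close> has weight 0 in both smearings.\<close>
    show "g x $ i $ j = 0" if "x \<in> divisions" "x $ i $ j = 0" for x i j
    proof -
      have "(\<Sum>s\<in>UNIV. if s i = j then p x s else 0) = 0"
        by (rule sum.neutral) (use that p(4) in auto)
      moreover have "(\<Sum>s\<in>UNIV. if s i = j then q x s else 0) = 0"
        by (rule sum.neutral) (use that q(4) in auto)
      ultimately show ?thesis by (simp add: g_def marginals_def)
    qed
  qed
  then obtain x where x: "x \<in> divisions" and gx: "\<And>i j. g x $ i $ j = 1 / real CARD('k)"
    by blast
  have "marginals (p x) $ i $ j + marginals (q x) $ i $ j = 2 / real CARD('k)" for i j
    using gx[of i j] by (simp add: g_def field_simps)
  then obtain s t where st: "p x s > 0" "q x t > 0" "disjoint_selections s t"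
    using disjoint_pair_in_support[OF p(2)[OF x] p(3)[OF x] q(2)[OF x] q(3)[OF x] _ card] by blast
  obtain y where y: "y \<in> divisions" "s \<in> PrefA y" "dist x y < e / 2" using p(5)[OF x st(1)] by blast
  obtain z where z: "z \<in> divisions" "t \<in> PrefB z" "dist x z < e / 2" using q(5)[OF x st(2)] by blast
  have "dist y z < e" using y(3) z(3) by (rule dist_triangle_half_r)
  with y z st show thesis using that by blast
qed

text \<open>Otherwise, for each disjoint pair \<open>s\<close>, \<open>t\<close>, the compact set
  where A prefers \<open>s\<close> misses the closed set where B prefers \<open>t\<close>, so the
  two are a positive distance apart. Finitely many pairs leave one positive bound, against the
  approximate solutions.\<close>

lemma disjoint_selections_exist:
  fixes PrefA PrefB :: "('m::finite, 'k::finite) preferences"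
  assumes card: "CARD('m) < CARD('k)"
    and A: "admissible_preferences PrefA" and B: "admissible_preferences PrefB"
  shows "\<exists>x\<in>divisions. \<exists>s\<in>PrefA x. \<exists>t\<in>PrefB x. disjoint_selections s t"
proof (rule ccontr)
  assume none: "\<not> ?thesis"
  have clA: "closed {x \<in> divisions. s \<in> PrefA x}" and clB: "closed {x \<in> divisions. s \<in> PrefB x}" for s
    using A B by (simp_all add: admissible_preferences_def closed_preferences_def)
  \<comment> \<open>Stating the gap for all small \<open>e\<close> lets the finitely many pairs
    \<open>s\<close>, \<open>t\<close> be treated separately, with no explicit minimum of their
    distances.\<close>
  have "\<forall>\<^sub>F e in at_right 0. \<forall>s t y z. disjoint_selections s t \<longrightarrow> y \<in> divisions \<longrightarrow> s \<in> PrefA y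
      \<longrightarrow> z \<in> divisions \<longrightarrow> t \<in> PrefB z \<longrightarrow> e \<le> dist y z"
  proof (intro eventually_all_finite)
    fix s t :: "'m \<Rightarrow> 'k"
    show "\<forall>\<^sub>F e in at_right 0. \<forall>y z. disjoint_selections s t \<longrightarrow> y \<in> divisions \<longrightarrow> s \<in> PrefA y
      \<longrightarrow> z \<in> divisions \<longrightarrow> t \<in> PrefB z \<longrightarrow> e \<le> dist y z"
    proof (cases "disjoint_selections s t")
      case True
      have "{x \<in> divisions. s \<in> PrefA x} \<inter> divisions = {x \<in> divisions. s \<in> PrefA x}" by blast
      then have "compact {x \<in> divisions. s \<in> PrefA x}"
        using closed_Int_compact[OF clA[of s] compact_divisions] by simp
      moreover have "{x \<in> divisions. s \<in> PrefA x} \<inter> {x \<in> divisions. t \<in> PrefB x} = {}"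
        using none True by blast
      ultimately have "\<exists>d>0. \<forall>y\<in>{x \<in> divisions. s \<in> PrefA x}. \<forall>z\<in>{x \<in> divisions. t \<in> PrefB x}. d \<le> dist y z"
        by (intro separate_compact_closed clB)
      then obtain d where d: "d > 0"
        "\<And>y z. y \<in> divisions \<Longrightarrow> s \<in> PrefA y \<Longrightarrow> z \<in> divisions \<Longrightarrow> t \<in> PrefB z \<Longrightarrow> d \<le> dist y z"
        by auto
      have "\<forall>\<^sub>F e in at_right 0. e < d"
        using d(1) by (rule eventually_at_right_real[THEN eventually_mono]) simp
      then show ?thesis
        by eventually_elim (meson d(2) less_imp_le order.trans)
    qed simp
  qed
  moreover have "\<forall>\<^sub>F e in at_right (0::real). 0 < e"
    by (rule eventually_at_right_less)
  ultimately have "\<forall>\<^sub>F e in at_right (0::real). False"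
  proof eventually_elim
    case (elim e)
    show False
    proof (rule approximate_disjoint_selections[OF card A B elim(2)])
      fix y z s t
      assume "y \<in> divisions" "s \<in> PrefA y" "z \<in> divisions" "t \<in> PrefB z"
        "disjoint_selections s t" and lt: "dist y z < e"
      then have "e \<le> dist y z" using elim(1) by blast
      with lt show False by simp
    qed
  qed
  then show False by simp
qed

theorem theorem8:
  fixes PrefA PrefB :: "(3, 'k::finite) preferences"
  assumes "CARD('k) \<ge> 4"
    and "admissible_preferences PrefA"
    and "admissible_preferences PrefB"
  shows "\<exists>x\<in>divisions. \<exists>sA\<in>PrefA x. \<exists>sB\<in>PrefB x. disjoint_selections sA sB"
  \<comment> \<open>With three cakes, m < k is the assumption that k is at least 4.\<close>
  using assms by (intro disjoint_selections_exist) auto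

end
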